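(* A finite metric space $X$ of negative type is of strictly negative type if and only if its distance matrix $D$ is invertible and satisfies $\operatorname{con}(D)\neq\infty$.
   Context: For a finite metric space $X=\{x_1,\dots,x_n\}$ with metric $d$, the distance matrix is $D=(d(x_i,x_j))_{i,j}$. Write $\mathbf{1}=(1,\dots,1)^{\mathrm T}\in\mathbb{R}^n$. $X$ is of negative type if $\mathbf{u}^{\mathrm T}D\mathbf{u}\le0$ for every $\mathbf{u}\in\mathbb{R}^n$ with $\mathbf{1}^{\mathrm T}\mathbf{u}=0$, and of strictly negative type if moreover equality holds only for $\mathbf{u}=\mathbf{0}$. A gauging for a symmetric real $n\times n$ matrix $A$ is a vector $\mathbf{v}\in\mathbb{R}^n$ with $\mathbf{1}^{\mathrm T}\mathbf{v}=1$ and $A\mathbf{v}=c\mathbf{1}$ for some $c\in\mathbb{R}$. All gaugings of $A$ have the same $c$; the concentration $\operatorname{con}(A)\in\mathbb{R}\cup\{\infty\}$ is this $c$ if a gauging exists, and $\infty$ otherwise.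
   Formalization: The space is assumed to have at least two points; for a one-point space the claim fails, since D = (0) is not invertible although the space is vacuously of strictly negative type. *)

theory Defs
  imports "HOL-Analysis.Analysis"
begin

(* A finite metric space X = {x_1, ..., x_n} is given by a carrier X, a metric d on it
   (locale Metric_space) and an enumeration x of X by a finite index type 'n, so n = CARD('n).
   The vector (1, ..., 1) is the library's 1 :: real ^ 'n. *)

definition distance_matrix :: "('a \<Rightarrow> 'a \<Rightarrow> real) \<Rightarrow> ('n \<Rightarrow> 'a) \<Rightarrow> real ^ 'n ^ 'n" where
  "distance_matrix d x = (\<chi> i j. d (x i) (x j))"

definition negative_type :: "('a \<Rightarrow> 'a \<Rightarrow> real) \<Rightarrow> ('n::finite \<Rightarrow> 'a) \<Rightarrow> bool" where
  "negative_type d x \<longleftrightarrow>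
     (\<forall>u::real ^ 'n. 1 \<bullet> u = 0 \<longrightarrow> u \<bullet> (distance_matrix d x *v u) \<le> 0)"

definition strictly_negative_type :: "('a \<Rightarrow> 'a \<Rightarrow> real) \<Rightarrow> ('n::finite \<Rightarrow> 'a) \<Rightarrow> bool" where
  "strictly_negative_type d x \<longleftrightarrow> negative_type d x \<and>
     (\<forall>u::real ^ 'n. 1 \<bullet> u = 0 \<and> u \<bullet> (distance_matrix d x *v u) = 0 \<longrightarrow> u = 0)"

definition gauging_with :: "real ^ 'n ^ 'n \<Rightarrow> real \<Rightarrow> real ^ 'n::finite \<Rightarrow> bool" where
  "gauging_with A c v \<longleftrightarrow> 1 \<bullet> v = 1 \<and> A *v v = c *\<^sub>R 1"

definition gauging :: "real ^ 'n ^ 'n \<Rightarrow> real ^ 'n::finite \<Rightarrow> bool" where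
  "gauging A v \<longleftrightarrow> (\<exists>c. gauging_with A c v)"

(* Only meaningful for symmetric A, where c does not depend on the gauging
   (gauging_with_unique); the value -\<infinity> of ereal never occurs. *)
definition con :: "real ^ 'n ^ 'n::finite \<Rightarrow> ereal" where
  "con A = (if \<exists>v. gauging A v then ereal (THE c. \<exists>v. gauging_with A c v) else \<infinity>)"

lemma gauging_with_unique:
  fixes A :: "real ^ 'n ^ 'n::finite"
  assumes sym: "transpose A = A" and v: "gauging_with A c v" and w: "gauging_with A c' w"
  shows "c = c'"
proof -
  have "w \<bullet> (A *v v) = v \<bullet> (A *v w)"
    using dot_lmul_matrix[of w A v] sym
    by (metis inner_commute transpose_matrix_vector)
  then show ?thesis
    using v w by (simp add: gauging_with_def inner_commute)
qed

lemma con_eq: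
  fixes A :: "real ^ 'n ^ 'n::finite"
  assumes "transpose A = A" "gauging_with A c v"
  shows "con A = ereal c"
proof -
  have "(THE c. \<exists>v. gauging_with A c v) = c"
    using assms gauging_with_unique by (intro the_equality) blast+
  then show ?thesis
    using assms(2) by (auto simp: con_def gauging_def)
qed

end

(* Forwards: a kernel vector u of D with 1 \<bullet> u = 1 would give an isotropic vector e - u, with e a
   standard basis vector, of coordinate sum 0 for every e, so D is invertible; then D^-1 1 has
   nonzero coordinate sum, as otherwise it would be isotropic, and can be normalised to a gauging.
   Backwards: an isotropic u of coordinate sum 0 lies, by Cauchy-Schwarz for the semidefinite form,
   in the radical of the form on the hyperplane 1 \<bullet> u = 0, so D u = k 1.  Pairing with a gauging
   gives k = 0. *)
theory Submission
  imports Defs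
begin

lemma inner_matrix_vector_symmetric:
  fixes A :: "real ^ 'n ^ 'n::finite"
  assumes "transpose A = A"
  shows "u \<bullet> (A *v w) = w \<bullet> (A *v u)"
  using dot_lmul_matrix[of u A w] assms
  by (metis inner_commute transpose_matrix_vector)

lemma inner_matrix_vector_add:
  fixes A :: "real ^ 'n ^ 'n::finite"
  assumes "transpose A = A"
  shows "(u + t *\<^sub>R w) \<bullet> (A *v (u + t *\<^sub>R w)) =
    u \<bullet> (A *v u) + 2 * t * (w \<bullet> (A *v u)) + t\<^sup>2 * (w \<bullet> (A *v w))"
  using inner_matrix_vector_symmetric[OF assms, of u w]
  by (simp add: matrix_vector_right_distrib matrix_vector_mult_scaleR inner_add_left
      inner_add_right power2_eq_square algebra_simps)

lemma invertible_iff_kernel_trivial: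
  fixes A :: "real ^ 'n ^ 'n::finite"
  shows "invertible A \<longleftrightarrow> (\<forall>u. A *v u = 0 \<longrightarrow> u = 0)"
  by (simp add: invertible_left_inverse matrix_left_invertible_ker)

lemma con_neq_infinity_iff: "con A \<noteq> \<infinity> \<longleftrightarrow> (\<exists>v. gauging A v)"
  by (simp add: con_def)

text \<open>Along the line \<open>u + t *\<^sub>R w\<close>, which stays in the hyperplane, the form
  is a quadratic polynomial in \<open>t\<close> without constant term. Being nowhere positive, it
  cannot have a nonzero linear coefficient.\<close>

lemma isotropic_in_radical:
  fixes A :: "real ^ 'n ^ 'n::finite"
  assumes sym: "transpose A = A"
    and nonpos: "\<And>w. 1 \<bullet> w = 0 \<Longrightarrow> w \<bullet> (A *v w) \<le> 0"
    and u: "1 \<bullet> u = 0" "u \<bullet> (A *v u) = 0" and w: "1 \<bullet> w = 0"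
  shows "w \<bullet> (A *v u) = 0"
proof -
  define a b where "a = w \<bullet> (A *v u)" and "b = w \<bullet> (A *v w)"
  have b: "b \<le> 0"
    using nonpos[OF w] by (simp add: b_def)
  \<comment> \<open>As \<open>b\<close> is nonpositive, the denominator is at least 1, so
    \<open>b = 0\<close> needs no separate case. Substituting \<open>a = t * (1 - b)\<close> turns
    the polynomial into \<open>t\<^sup>2 * (2 - b)\<close>, whose second factor is positive.\<close>
  define t where "t = a / (1 - b)"
  have "1 \<bullet> (u + t *\<^sub>R w) = 0"
    using u w by (simp add: inner_add_right)
  from nonpos[OF this] have "2 * t * a + t\<^sup>2 * b \<le> 0"
    using u inner_matrix_vector_add[OF sym, of u t w] by (simp add: a_def b_def)
  moreover have a: "a = t * (1 - b)"
    using b by (simp add: t_def)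
  ultimately have "t\<^sup>2 * (2 - b) \<le> 0"
    by (simp add: power2_eq_square algebra_simps)
  with b have "t = 0"
    by (smt (verit) mult_pos_pos zero_less_power2)
  with a show ?thesis
    by (simp add: a_def)
qed

lemma isotropic_image_constant:
  fixes A :: "real ^ 'n ^ 'n::finite"
  assumes "transpose A = A"
    and "\<And>w. 1 \<bullet> w = 0 \<Longrightarrow> w \<bullet> (A *v w) \<le> 0"
    and "1 \<bullet> u = 0" "u \<bullet> (A *v u) = 0"
  shows "\<exists>k. A *v u = k *\<^sub>R 1"
proof -
  \<comment> \<open>\<open>k\<close> is the mean of the coordinates of \<open>A *v u\<close>, so
    \<open>w\<close> is the orthogonal projection of \<open>A *v u\<close> to the hyperplane. It is
    orthogonal to both \<open>A *v u\<close> and \<open>1\<close>, hence to itself.\<close>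
  define k where "k = (1 \<bullet> (A *v u)) / (1 \<bullet> (1 :: real ^ 'n))"
  define w where "w = A *v u - k *\<^sub>R 1"
  have w: "1 \<bullet> w = 0"
    by (simp add: w_def k_def inner_diff_right)
  have "w \<bullet> w = w \<bullet> (A *v u) - k * (1 \<bullet> w)"
    by (simp add: w_def inner_diff_right inner_commute algebra_simps)
  also have "\<dots> = 0"
    using isotropic_in_radical[OF assms w] w by simp
  finally show ?thesis
    by (auto simp: w_def)
qed

lemma transpose_distance_matrix:
  assumes "Metric_space X d"
  shows "transpose (distance_matrix d x) = distance_matrix d x"
  using Metric_space.commute[OF assms] by (simp add: transpose_def distance_matrix_def vec_eq_iff)

lemma inner_axis_distance_matrix:
  assumes "Metric_space X d" "x i \<in> X"
  shows "axis i 1 \<bullet> (distance_matrix d x *v axis i 1) = 0"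
  using Metric_space.zero[OF assms(1) assms(2) assms(2)]
  by (simp add: inner_axis' matrix_vector_mul_component distance_matrix_def inner_axis)

theorem proposition4p10:
  fixes X :: "'a set" and d :: "'a \<Rightarrow> 'a \<Rightarrow> real" and x :: "'n::finite \<Rightarrow> 'a"
  assumes "Metric_space X d"
    and "bij_betw x UNIV X"
    and "2 \<le> card X"
    and "negative_type d x"
  shows "strictly_negative_type d x \<longleftrightarrow>
    invertible (distance_matrix d x) \<and> con (distance_matrix d x) \<noteq> \<infinity>"
proof -
  define D where "D = distance_matrix d x"
  have sym: "transpose D = D"
    using transpose_distance_matrix[OF assms(1)] by (simp add: D_def)
  have nonpos: "w \<bullet> (D *v w) \<le> 0" if "1 \<bullet> w = 0" for w
    using assms(4) that by (simp add: negative_type_def D_def)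
  have strict_iff: "strictly_negative_type d x \<longleftrightarrow>
      (\<forall>u. 1 \<bullet> u = 0 \<and> u \<bullet> (D *v u) = 0 \<longrightarrow> u = 0)"
    using assms(4) by (simp add: strictly_negative_type_def D_def)
  show ?thesis
    unfolding D_def[symmetric] strict_iff con_neq_infinity_iff
  proof (intro iffI conjI)
    assume strict: "\<forall>u. 1 \<bullet> u = 0 \<and> u \<bullet> (D *v u) = 0 \<longrightarrow> u = 0"
    show inv: "invertible D"
      unfolding invertible_iff_kernel_trivial
    proof (intro allI impI)
      fix z assume z: "D *v z = 0"
      have "1 \<bullet> z = 0"
      proof (rule ccontr)
        assume nz: "1 \<bullet> z \<noteq> 0"
        define u where "u = (1 / (1 \<bullet> z)) *\<^sub>R z"
        have u: "1 \<bullet> u = 1" "D *v u = 0"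
          using nz z by (simp_all add: u_def matrix_vector_mult_scaleR)
        have eq: "u = axis i 1" for i
        proof -
          have "x i \<in> X"
            using assms(2) by (auto simp: bij_betw_def)
          then have "axis i 1 \<bullet> (D *v axis i 1) = 0"
            unfolding D_def by (rule inner_axis_distance_matrix[OF assms(1)])
          \<comment> \<open>All three terms of the expansion at \<open>t = -1\<close> vanish: two
            because \<open>u\<close> lies in the kernel, the last because the diagonal of
            \<open>D\<close> is zero.\<close>
          then have "(u + (-1) *\<^sub>R axis i 1) \<bullet> (D *v (u + (-1) *\<^sub>R axis i 1)) = 0"
            unfolding inner_matrix_vector_add[OF sym] by (simp add: u)
          moreover have "1 \<bullet> (u + (-1) *\<^sub>R axis i 1) = 0"
            using u by (simp add: inner_diff_right inner_axis)
          ultimately have "u + (-1) *\<^sub>R axis i 1 = 0"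
            using strict by blast
          then show ?thesis
            by simp
        qed
        \<comment> \<open>A second point is essential: a one-point space is of strictly negative
          type, but its matrix is zero.\<close>
        have "2 \<le> CARD('n)"
          using assms(3) bij_betw_same_card[OF assms(2)] by simp
        then obtain i j :: 'n where "i \<noteq> j"
          by (metis (full_types) UNIV_I card_le_Suc0_iff_eq finite not_less_eq_eq numeral_2_eq_2)
        with eq[of i] eq[of j] show False
          by (simp add: axis_eq_axis)
      qed
      with z strict show "z = 0"
        by simp
    qed
    from inv obtain B where "D ** B = mat 1"
      by (auto simp: invertible_def)
    then have Dw: "D *v (B *v 1) = 1"
      by (simp add: matrix_vector_mul_assoc)
    define w where "w = B *v 1"
    have "1 \<bullet> w \<noteq> 0"
    proof
      assume "1 \<bullet> w = 0"
      \<comment> \<open>Since \<open>D *v w = 1\<close>, the value of the form at \<open>w\<close>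
        is the coordinate sum of \<open>w\<close> itself.\<close>
      then have "w = 0"
        using strict Dw by (simp add: w_def inner_commute)
      with Dw show False
        by (simp add: w_def)
    qed
    then have "gauging_with D (1 / (1 \<bullet> w)) ((1 / (1 \<bullet> w)) *\<^sub>R w)"
      using Dw by (simp add: gauging_with_def matrix_vector_mult_scaleR w_def)
    then show "\<exists>v. gauging D v"
      by (auto simp: gauging_def)
  next
    assume inv_gauging: "invertible D \<and> (\<exists>v. gauging D v)"
    then obtain v c where v: "1 \<bullet> v = 1" "D *v v = c *\<^sub>R 1"
      by (auto simp: gauging_def gauging_with_def)
    show "\<forall>u. 1 \<bullet> u = 0 \<and> u \<bullet> (D *v u) = 0 \<longrightarrow> u = 0"
    proof (intro allI impI, elim conjE)
      fix u assume u: "1 \<bullet> u = 0" "u \<bullet> (D *v u) = 0"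
      obtain k where k: "D *v u = k *\<^sub>R 1"
        using isotropic_image_constant[OF sym nonpos u] by blast
      \<comment> \<open>By symmetry \<open>v \<bullet> (D *v u)\<close>, which is \<open>k\<close>,
        equals \<open>u \<bullet> (D *v v)\<close>, which is \<open>c\<close> times the coordinate
        sum of \<open>u\<close>. The gauging thus puts \<open>u\<close> in the kernel, and
        invertibility does the rest.\<close>
      have "k = 0"
        using inner_matrix_vector_symmetric[OF sym, of v u] u v k by (simp add: inner_commute)
      with k inv_gauging show "u = 0"
        by (simp add: invertible_iff_kernel_trivial)
    qed
  qed
qed

end
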